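(* Consider the linear Gaussian state space system described in the context and suppose the observation model is well specified, so that at time $n$, given the forecast mean $m_n^f$ and covariance $P_n^f$, $Y_n\sim\mathcal{N}(H_nm_n^f,\Sigma_n)$ with $\Sigma_n=H_nP_n^fH_n^T+R_n$. Choose the threshold parameter $q^2=d_Y$. Then the analysis precision of the diffusion score matching (DSM) Kalman filter is asymptotically unbiased for the analysis precision of the regular Kalman filter as $d_Y\to\infty$, in the sense that the DSM analysis precision $J_n^a=J_n^f+2k_n^2(Y_n)H_n^TR_n^{-1}H_n$ satisfies $$\mathbb{E}_{Y_n}[J_n^a]=J_n^f+\mathbb{E}_{Y_n}\left[2k_n^2(Y_n)\right]H_n^TR_n^{-1}H_n\quad\text{with}\quad \mathbb{E}_{Y_n}\left[2k_n^2(Y_n)\right]\to1\ \text{ as } d_Y\to\infty,$$ whereas the regular Kalman filter analysis precision is $J_n^f+H_n^TR_n^{-1}H_n$.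
   Context: System: $X_n=A_nX_{n-1}+Q_n^{1/2}W_n$, $Y_n=H_nX_n+R_n^{1/2}V_n$ with $X_n\in\mathbb{R}^{d_X}$, $Y_n\in\mathbb{R}^{d_Y}$, $W_n,V_n$ independent standard Gaussian vectors, $A_n,H_n$ matrices of appropriate dimensions, $Q_n,R_n$ symmetric positive definite. $P_n^f$ is the (symmetric positive definite) forecast covariance and $J_n^f=(P_n^f)^{-1}$ the forecast precision; the analysis precision is the inverse of the analysis covariance. The limit is taken over systems with growing observation dimension $d_Y$. The DSM Kalman filter replaces the observation covariance $R_n$ in the analysis step by $N_n(Y_n)=\frac{1}{2k_n^2(Y_n)}R_n$, where $$k_n(y)=\left(1+\frac{\|y-H_nm_n^f\|^2_{\Sigma_n^{-1}}}{q^2}\right)^{-1/2},\qquad \|v\|^2_{\Sigma^{-1}}=v^T\Sigma^{-1}v.$$ *)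

theory Defs
  imports
    "HOL-Probability.Probability"
    "Jordan_Normal_Form.Determinant"
    "Jordan_Normal_Form.Gauss_Jordan_Elimination"
begin

text \<open>
  The observation dimension varies inside the statement, so vectors and matrices are those of
  \<^theory>\<open>Jordan_Normal_Form.Matrix\<close>, with explicit dimensions; their notation is given
  precedence over that of the type-indexed vectors of HOL-Analysis.
\<close>

no_notation inner (infix "\<bullet>" 70)
no_notation Finite_Cartesian_Product.vec_nth (infixl "$" 90)

definition sym_pos_def :: "nat \<Rightarrow> real Matrix.mat \<Rightarrow> bool" where
  "sym_pos_def d A \<longleftrightarrow>
     A \<in> carrier_mat d d \<and> A\<^sup>T = A \<and>
     (\<forall>v \<in> carrier_vec d. v \<noteq> 0\<^sub>v d \<longrightarrow> v \<bullet> (A *\<^sub>v v) > 0)"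

text \<open>Only meaningful for invertible matrices.\<close>
definition mat_inv :: "real Matrix.mat \<Rightarrow> real Matrix.mat" where
  "mat_inv A = the (mat_inverse A)"

definition weighted_sq_norm :: "real Matrix.mat \<Rightarrow> real Matrix.vec \<Rightarrow> real" where
  "weighted_sq_norm B v = v \<bullet> (B *\<^sub>v v)"

definition gaussian_density ::
  "nat \<Rightarrow> real Matrix.vec \<Rightarrow> real Matrix.mat \<Rightarrow> real Matrix.vec \<Rightarrow> real" where
  "gaussian_density d \<mu> \<Sigma> y =
     exp (- weighted_sq_norm (mat_inv \<Sigma>) (y - \<mu>) / 2) / sqrt ((2 * pi) ^ d * Determinant.det \<Sigma>)"

text \<open>
  The nondegenerate normal law on \<open>\<real>\<^sup>d\<close> for symmetric positive definite \<open>\<Sigma>\<close>. The type of vectors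
  carries no measurable structure, so the law lives on the \<open>d\<close>-fold product of Lebesgue measure.
\<close>
definition gaussian_vector ::
  "'a measure \<Rightarrow> nat \<Rightarrow> real Matrix.vec \<Rightarrow> real Matrix.mat \<Rightarrow> ('a \<Rightarrow> real Matrix.vec) \<Rightarrow> bool" where
  "gaussian_vector M d \<mu> \<Sigma> Y \<longleftrightarrow>
     (\<forall>\<omega> \<in> space M. Y \<omega> \<in> carrier_vec d) \<and>
     distributed M (\<Pi>\<^sub>M i\<in>{..<d}. lborel) (\<lambda>\<omega>. \<lambda>i\<in>{..<d}. Y \<omega> $ i)
       (\<lambda>y. ennreal (gaussian_density d \<mu> \<Sigma> (Matrix.vec d y)))"

definition innovation_cov ::
  "real Matrix.mat \<Rightarrow> real Matrix.mat \<Rightarrow> real Matrix.mat \<Rightarrow> real Matrix.mat" where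
  "innovation_cov H P R = H * P * H\<^sup>T + R"

definition kalman_gain ::
  "real Matrix.mat \<Rightarrow> real Matrix.mat \<Rightarrow> real Matrix.mat \<Rightarrow> real Matrix.mat" where
  "kalman_gain H P R = P * H\<^sup>T * mat_inv (innovation_cov H P R)"

definition analysis_cov ::
  "real Matrix.mat \<Rightarrow> real Matrix.mat \<Rightarrow> real Matrix.mat \<Rightarrow> real Matrix.mat" where
  "analysis_cov H P R = (1\<^sub>m (dim_row P) - kalman_gain H P R * H) * P"

definition analysis_precision ::
  "real Matrix.mat \<Rightarrow> real Matrix.mat \<Rightarrow> real Matrix.mat \<Rightarrow> real Matrix.mat" where
  "analysis_precision H P R = mat_inv (analysis_cov H P R)"

definition dsm_k ::
  "real \<Rightarrow> real Matrix.mat \<Rightarrow> real Matrix.vec \<Rightarrow> real Matrix.mat \<Rightarrow> real Matrix.mat \<Rightarrow>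
   real Matrix.vec \<Rightarrow> real" where
  "dsm_k q H m P R y =
     (1 + weighted_sq_norm (mat_inv (innovation_cov H P R)) (y - H *\<^sub>v m) / q\<^sup>2) powr (- 1 / 2)"

definition dsm_obs_cov ::
  "real \<Rightarrow> real Matrix.mat \<Rightarrow> real Matrix.vec \<Rightarrow> real Matrix.mat \<Rightarrow> real Matrix.mat \<Rightarrow>
   real Matrix.vec \<Rightarrow> real Matrix.mat" where
  "dsm_obs_cov q H m P R y = (1 / (2 * (dsm_k q H m P R y)\<^sup>2)) \<cdot>\<^sub>m R"

definition dsm_analysis_precision ::
  "real \<Rightarrow> real Matrix.mat \<Rightarrow> real Matrix.vec \<Rightarrow> real Matrix.mat \<Rightarrow> real Matrix.mat \<Rightarrow>
   real Matrix.vec \<Rightarrow> real Matrix.mat" where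
  "dsm_analysis_precision q H m P R y = analysis_precision H P (dsm_obs_cov q H m P R y)"

definition mat_expectation ::
  "'a measure \<Rightarrow> nat \<Rightarrow> nat \<Rightarrow> ('a \<Rightarrow> real Matrix.mat) \<Rightarrow> real Matrix.mat" where
  "mat_expectation M nr nc F =
     Matrix.mat nr nc (\<lambda>(i, j). integral\<^sup>L M (\<lambda>\<omega>. F \<omega> $$ (i, j)))"

end

theory Submission
  imports Defs
begin

text \<open>
  The matrix identities are instances of the Woodbury formula. For the limit, let \<open>U\<close> be the squared
  Mahalanobis norm of the innovation. Rescaling the Gaussian integral about its mean gives
  \<open>E (exp (- a U)) = (1 + 2 a) powr (- d / 2)\<close>, and writing \<open>1 / (1 + U / d)\<close> as the integral of
  \<open>exp (- s (1 + U / d))\<close> over \<open>s \<ge> 0\<close> turns \<open>E (k\<^sup>2)\<close> into the integral of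
  \<open>exp (- s) (1 + 2 s / d) powr (- d / 2)\<close>. By dominated convergence this tends to the integral of
  \<open>exp (- 2 s)\<close>, which is \<open>1 / 2\<close>.
\<close>

section \<open>Matrix inverses and positive definite quadratic forms\<close>

text \<open>A one-sided inverse of a square matrix over a field is two-sided. Hence \<open>A\<close>
  is a unit, \<open>mat_inverse\<close> really returns a value, and that value equals
  \<open>B\<close> by associativity.\<close>

lemma mat_inv_eqI:
  assumes A: "A \<in> carrier_mat d d" and B: "B \<in> carrier_mat d d" and AB: "A * B = 1\<^sub>m d"
  shows "mat_inv A = B"
proof -
  have "A \<in> Units (ring_mat TYPE(real) d ())"
    using A B AB mat_mult_left_right_inverse[OF A B AB]
    by (auto simp: Units_def ring_mat_def)
  then obtain C where C: "mat_inverse A = Some C"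
    using mat_inverse(1)[OF A, where b = "()"] by (cases "mat_inverse A") auto
  then have CA: "C * A = 1\<^sub>m d" "C \<in> carrier_mat d d"
    using mat_inverse(2)[OF A] by auto
  have "C = C * (A * B)"
    using CA AB by simp
  also have "\<dots> = (C * A) * B"
    using assoc_mult_mat[OF CA(2) A B] by simp
  finally show ?thesis
    using B C CA(1) by (simp add: mat_inv_def)
qed

text \<open>A nonzero \<open>v\<close> with \<open>A *\<^sub>v v\<close> zero would make the
  quadratic form vanish at \<open>v\<close>. So the kernel is trivial, the determinant is nonzero,
  and \<open>the\<close> in \<open>mat_inv\<close> is applied to a genuine inverse.\<close>

lemma sym_pos_def_mat_inv:
  assumes "sym_pos_def d A"
  shows "mat_inv A \<in> carrier_mat d d" "A * mat_inv A = 1\<^sub>m d" "mat_inv A * A = 1\<^sub>m d"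
proof -
  have A: "A \<in> carrier_mat d d"
    and pos: "\<And>v. v \<in> carrier_vec d \<Longrightarrow> v \<noteq> 0\<^sub>v d \<Longrightarrow> v \<bullet> (A *\<^sub>v v) > 0"
    using assms by (auto simp: sym_pos_def_def)
  have "Determinant.det A \<noteq> 0"
    using pos by (fastforce simp: det_0_iff_vec_prod_zero[OF A])
  from det_non_zero_imp_unit[OF A this, where b = "()"]
  obtain C where C: "mat_inverse A = Some C"
    using mat_inverse(1)[OF A, where b = "()"] by (cases "mat_inverse A") auto
  then show "mat_inv A \<in> carrier_mat d d" "A * mat_inv A = 1\<^sub>m d" "mat_inv A * A = 1\<^sub>m d"
    using mat_inverse(2)[OF A C] by (auto simp: mat_inv_def)
qed

lemma weighted_sq_norm_nonneg:
  assumes "sym_pos_def d A" "v \<in> carrier_vec d"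
  shows "weighted_sq_norm A v \<ge> 0"
proof (cases "v = 0\<^sub>v d")
  case True
  then show ?thesis
    using assms by (auto simp: sym_pos_def_def weighted_sq_norm_def
        intro!: scalar_prod_left_zero[THEN eq_refl, OF mult_mat_vec_carrier])
next
  case False
  then show ?thesis
    using assms by (auto simp: sym_pos_def_def weighted_sq_norm_def intro!: less_imp_le)
qed

text \<open>With \<open>w = mat_inv A *\<^sub>v v\<close> the form of the inverse at
  \<open>v\<close> is the form of \<open>A\<close> at \<open>w\<close>, so positivity is read off
  from \<open>A\<close> itself.\<close>

lemma weighted_sq_norm_mat_inv_nonneg:
  assumes A: "sym_pos_def d A" and v: "v \<in> carrier_vec d"
  shows "weighted_sq_norm (mat_inv A) v \<ge> 0"
proof -
  note inv = sym_pos_def_mat_inv[OF A]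
  have A': "A \<in> carrier_mat d d"
    using A by (simp add: sym_pos_def_def)
  define w where "w = mat_inv A *\<^sub>v v"
  have w: "w \<in> carrier_vec d"
    using inv v by (auto simp: w_def)
  have Aw: "A *\<^sub>v w = v"
    using inv v assoc_mult_mat_vec[OF A' inv(1) v] by (simp add: w_def)
  have "weighted_sq_norm (mat_inv A) v = weighted_sq_norm A w"
    unfolding weighted_sq_norm_def Aw using comm_scalar_prod[OF v w] by (simp add: w_def)
  then show ?thesis
    using weighted_sq_norm_nonneg[OF A w] by simp
qed

lemma sym_pos_def_smult:
  assumes "sym_pos_def d A" "c > 0"
  shows "sym_pos_def d (c \<cdot>\<^sub>m A)"
proof -
  have A: "A \<in> carrier_mat d d"
    using assms by (simp add: sym_pos_def_def)
  have "v \<bullet> ((c \<cdot>\<^sub>m A) *\<^sub>v v) = c * (v \<bullet> (A *\<^sub>v v))" if "v \<in> carrier_vec d" for v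
  proof -
    have "(c \<cdot>\<^sub>m A) *\<^sub>v v = c \<cdot>\<^sub>v (A *\<^sub>v v)"
      using A that by (intro eq_vecI) auto
    then show ?thesis
      using A that by simp
  qed
  moreover have "(c \<cdot>\<^sub>m A)\<^sup>T = c \<cdot>\<^sub>m A\<^sup>T"
    by (intro eq_matI) auto
  ultimately show ?thesis
    using assms by (auto simp: sym_pos_def_def)
qed

lemma mat_inv_smult:
  assumes A: "sym_pos_def d A" and c: "c \<noteq> 0"
  shows "mat_inv (c \<cdot>\<^sub>m A) = (1 / c) \<cdot>\<^sub>m mat_inv A"
proof (rule mat_inv_eqI)
  note inv = sym_pos_def_mat_inv[OF A]
  have A': "A \<in> carrier_mat d d"
    using A by (simp add: sym_pos_def_def)
  show "c \<cdot>\<^sub>m A \<in> carrier_mat d d" "(1 / c) \<cdot>\<^sub>m mat_inv A \<in> carrier_mat d d"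
    using A' inv by auto
  have "(c \<cdot>\<^sub>m A) * ((1 / c) \<cdot>\<^sub>m mat_inv A) = c \<cdot>\<^sub>m ((1 / c) \<cdot>\<^sub>m (A * mat_inv A))"
    using A' inv(1)
    by (simp add: mult_smult_assoc_mat[OF A' smult_carrier_mat[OF inv(1)]] mult_smult_distrib[OF A' inv(1)])
  also have "\<dots> = 1\<^sub>m d"
    using c inv by (intro eq_matI) auto
  finally show "(c \<cdot>\<^sub>m A) * ((1 / c) \<cdot>\<^sub>m mat_inv A) = 1\<^sub>m d" .
qed

section \<open>The innovation covariance and the Woodbury formula\<close>

text \<open>The first summand contributes the form of \<open>P\<close> at
  \<open>H\<^sup>T *\<^sub>v v\<close>, which is only nonnegative because \<open>H\<^sup>T\<close>
  may have a kernel. Strictness comes from \<open>R\<close>.\<close>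

lemma sym_pos_def_innovation_cov:
  assumes H: "H \<in> carrier_mat n k" and P: "sym_pos_def k P" and R: "sym_pos_def n R"
  shows "sym_pos_def n (innovation_cov H P R)"
proof -
  have P': "P \<in> carrier_mat k k" "P\<^sup>T = P" and R': "R \<in> carrier_mat n n" "R\<^sup>T = R"
    and Rpos: "\<And>v. v \<in> carrier_vec n \<Longrightarrow> v \<noteq> 0\<^sub>v n \<Longrightarrow> v \<bullet> (R *\<^sub>v v) > 0"
    using P R by (auto simp: sym_pos_def_def)
  have HT: "H\<^sup>T \<in> carrier_mat k n"
    using H by simp
  have HPH: "H * P * H\<^sup>T \<in> carrier_mat n n"
    using H P' by auto
  have "(H * P * H\<^sup>T)\<^sup>T = H * P * H\<^sup>T"
    using H P' HT
    by (simp add: transpose_mult[OF mult_carrier_mat[OF H P'(1)] HT] transpose_mult[OF H P'(1)]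
        assoc_mult_mat[OF H P'(1) HT, symmetric] del: assoc_mult_mat)
  then have "(innovation_cov H P R)\<^sup>T = innovation_cov H P R"
    using HPH R' by (simp add: innovation_cov_def transpose_add)
  moreover have "v \<bullet> (innovation_cov H P R *\<^sub>v v) > 0" if v: "v \<in> carrier_vec n" "v \<noteq> 0\<^sub>v n" for v
  proof -
    have w: "H\<^sup>T *\<^sub>v v \<in> carrier_vec k"
      using HT v by auto
    have "v \<bullet> ((H * P * H\<^sup>T) *\<^sub>v v) = v \<bullet> (H *\<^sub>v (P *\<^sub>v (H\<^sup>T *\<^sub>v v)))"
      using H P' HT v w
      by (simp add: assoc_mult_mat_vec[OF mult_carrier_mat[OF H P'(1)] HT v(1)]
          assoc_mult_mat_vec[OF H P'(1) w] del: assoc_mult_mat)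
    also have "\<dots> = weighted_sq_norm P (H\<^sup>T *\<^sub>v v)"
      using transpose_vec_mult_scalar[OF H mult_mat_vec_carrier[OF P'(1) w] v(1)]
      by (simp add: weighted_sq_norm_def)
    finally have "v \<bullet> ((H * P * H\<^sup>T) *\<^sub>v v) \<ge> 0"
      using weighted_sq_norm_nonneg[OF P w] by simp
    moreover have "v \<bullet> (innovation_cov H P R *\<^sub>v v) = v \<bullet> ((H * P * H\<^sup>T) *\<^sub>v v) + v \<bullet> (R *\<^sub>v v)"
      unfolding innovation_cov_def add_mult_distrib_mat_vec[OF HPH R'(1) v(1)]
      by (rule scalar_prod_add_distrib) (use HPH R' v in auto)
    ultimately show ?thesis
      using Rpos[OF v] by simp
  qed
  ultimately show ?thesis
    using HPH R' by (auto simp: sym_pos_def_def innovation_cov_def)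
qed

text \<open>In the notation of the proof the analysis covariance is \<open>(1 - X) * P\<close>, and
  \<open>P\<close> times the claimed precision is \<open>1 + Z\<close>. The formula thus reduces to
  \<open>(1 - X) * (1 + Z) = 1\<close>, that is, to \<open>Z = X * Z + X\<close>.\<close>

lemma analysis_precision_eq:
  assumes H: "H \<in> carrier_mat n k" and P: "sym_pos_def k P" and R: "sym_pos_def n R"
  shows "analysis_precision H P R = mat_inv P + H\<^sup>T * mat_inv R * H"
  unfolding analysis_precision_def
proof (rule mat_inv_eqI)
  note Pi = sym_pos_def_mat_inv[OF P] and Ri = sym_pos_def_mat_inv[OF R]
    and Si = sym_pos_def_mat_inv[OF sym_pos_def_innovation_cov[OF H P R]]
  have Pc: "P \<in> carrier_mat k k" and Rc: "R \<in> carrier_mat n n"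
    using P R by (auto simp: sym_pos_def_def)
  define G where "G = P * H\<^sup>T"
  define S where "S = innovation_cov H P R"
  define X where "X = G * mat_inv S * H"
  define Z where "Z = G * mat_inv R * H"
  note Si = Si[folded S_def]
  have G: "G \<in> carrier_mat k n" and HT: "H\<^sup>T \<in> carrier_mat k n"
    using Pc H by (auto simp: G_def)
  have X: "X \<in> carrier_mat k k" and Z: "Z \<in> carrier_mat k k"
    using G H Ri Si by (auto simp: X_def Z_def)
  have HG: "H * G \<in> carrier_mat n n"
    using H G by auto
  have SHG: "S = H * G + R"
    using H Pc HT by (simp add: S_def innovation_cov_def G_def)
  \<comment> \<open>Inserting \<open>S = H * G + R\<close> between the two inverses gives a
    resolvent identity; multiplying it by \<open>G\<close> on the left and \<open>H\<close> on the
    right yields \<open>Z = X * Z + X\<close>.\<close>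
  have "mat_inv R = mat_inv S * S * mat_inv R"
    using Si Ri by simp
  also have "\<dots> = mat_inv S * (H * G) * mat_inv R + mat_inv S * R * mat_inv R"
    unfolding SHG
    by (simp only: mult_add_distrib_mat[OF Si(1)[unfolded SHG] HG Rc]
        add_mult_distrib_mat[OF mult_carrier_mat[OF Si(1)[unfolded SHG] HG]
          mult_carrier_mat[OF Si(1)[unfolded SHG] Rc] Ri(1)])
  also have "mat_inv S * R * mat_inv R = mat_inv S"
    using assoc_mult_mat[OF Si(1) Rc Ri(1)] Ri Si by simp
  finally have Ri_eq: "mat_inv R = mat_inv S * (H * G) * mat_inv R + mat_inv S" .
  have "Z = G * (mat_inv S * (H * G) * mat_inv R) * H + X"
    unfolding Z_def X_def using Si Ri HG G H
    by (subst Ri_eq, subst mult_add_distrib_mat[OF G _ Si(1)])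
       (auto intro!: add_mult_distrib_mat mult_carrier_mat simp del: assoc_mult_mat)
  also have "G * (mat_inv S * (H * G) * mat_inv R) * H = X * Z"
  proof -
    \<comment> \<open>Both sides are the same six-factor product up to bracketing. The general
      associativity rule leaves dimensions undetermined in its premises, so instances with explicit
      dimensions are used.\<close>
    note [simp] = assoc_mult_mat[of _ k n _ n _ n] assoc_mult_mat[of _ k n _ n _ k]
      assoc_mult_mat[of _ n n _ n _ k] assoc_mult_mat[of _ n n _ n _ n]
      assoc_mult_mat[of _ k n _ k _ k] assoc_mult_mat[of _ n n _ k _ k] assoc_mult_mat[of _ n n _ k _ n]
      assoc_mult_mat[of _ n k _ n _ n] assoc_mult_mat[of _ n k _ n _ k]
    show ?thesis
      unfolding X_def Z_def using Si Ri G H HG by (simp del: Matrix.assoc_mult_mat)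
  qed
  finally have ZX: "Z = X * Z + X" .
  have C: "analysis_cov H P R = (1\<^sub>m k - X) * P"
    using Pc by (simp add: analysis_cov_def kalman_gain_def X_def G_def S_def)
  then show "analysis_cov H P R \<in> carrier_mat k k"
    using X Pc by auto
  have J: "H\<^sup>T * mat_inv R * H \<in> carrier_mat k k"
    using HT H Ri by auto
  then show JJ: "mat_inv P + H\<^sup>T * mat_inv R * H \<in> carrier_mat k k"
    using Pi by auto
  have PJ: "P * (mat_inv P + H\<^sup>T * mat_inv R * H) = 1\<^sub>m k + Z"
    using Pi Ri Pc H HT
    by (simp add: mult_add_distrib_mat[OF Pc Pi(1) J] Z_def G_def
        assoc_mult_mat[OF Pc HT Ri(1)] assoc_mult_mat[OF Pc mult_carrier_mat[OF HT Ri(1)] H]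
        del: assoc_mult_mat)
  have "analysis_cov H P R * (mat_inv P + H\<^sup>T * mat_inv R * H) = (1\<^sub>m k - X) * (1\<^sub>m k + Z)"
    unfolding C PJ[symmetric] using X by (intro assoc_mult_mat[OF _ Pc JJ]) auto
  also have "\<dots> = (1\<^sub>m k + Z) - X * (1\<^sub>m k + Z)"
    using X Z by (subst minus_mult_distrib_mat[OF one_carrier_mat X]) auto
  also have "X * (1\<^sub>m k + Z) = X + X * Z"
    using X Z by (simp add: mult_add_distrib_mat[OF X one_carrier_mat Z])
  also have "\<dots> = Z"
    using X Z by (subst (2) ZX) (auto intro: comm_add_mat)
  also have "1\<^sub>m k + Z - Z = 1\<^sub>m k"
    using Z by (intro eq_matI) auto
  finally show "analysis_cov H P R * (mat_inv P + H\<^sup>T * mat_inv R * H) = 1\<^sub>m k" .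
qed

section \<open>Laplace transform of a Gaussian quadratic form\<close>

text \<open>The map scales every coordinate by the same \<open>c\<close>, so the substitution can be
  made one coordinate at a time: Tonelli splits off a coordinate, and each one-dimensional
  substitution contributes a factor \<open>\<bar>c\<bar>\<close>.\<close>

lemma nn_integral_PiM_lborel_affine:
  fixes c :: real and t :: "'i \<Rightarrow> real"
  assumes "finite I" and c: "c \<noteq> 0"
    and "f \<in> borel_measurable (\<Pi>\<^sub>M i\<in>I. lborel)"
  shows "(\<integral>\<^sup>+x. f x \<partial>(\<Pi>\<^sub>M i\<in>I. lborel)) =
    ennreal (\<bar>c\<bar> ^ card I) * (\<integral>\<^sup>+x. f (\<lambda>i\<in>I. t i + c * x i) \<partial>(\<Pi>\<^sub>M i\<in>I. lborel))"
  using assms(1,3)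
proof (induction I arbitrary: f rule: finite_induct)
  case empty
  then show ?case
    by (simp add: PiM_empty nn_integral_count_space_finite restrict_def)
next
  case (insert i I)
  interpret product_sigma_finite "\<lambda>_. lborel :: real measure"
    by standard
  let ?L = "\<lambda>I. \<Pi>\<^sub>M i\<in>I. (lborel :: real measure)"
  note [measurable] = insert.prems
  \<comment> \<open>The induction hypothesis is applied to the function left after integrating out
    the new coordinate.\<close>
  define g where "g = (\<lambda>x. \<integral>\<^sup>+y. f (x(i := y)) \<partial>lborel)"
  have [measurable]: "(\<lambda>(x, y). f (x(i := y))) \<in> borel_measurable (?L I \<Otimes>\<^sub>M lborel)"
    by measurable
  have g [measurable]: "g \<in> borel_measurable (?L I)"
    unfolding g_def by measurable
  have upd: "(\<lambda>j\<in>insert i I. t j + c * (x(i := y)) j) = (\<lambda>j\<in>I. t j + c * x j)(i := t i + c * y)" for x y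
    using insert.hyps by (auto simp: fun_eq_iff)
  have aff: "(\<lambda>j\<in>I. t j + c * x j) \<in> space (?L I)" for x
    by (auto simp: space_PiM)
  have inner: "g (\<lambda>j\<in>I. t j + c * x j) =
      ennreal \<bar>c\<bar> * (\<integral>\<^sup>+y. f (\<lambda>j\<in>insert i I. t j + c * (x(i := y)) j) \<partial>lborel)" for x
    unfolding g_def upd
    by (rule nn_integral_real_affine[OF _ c]) (use aff[of x] in measurable)
  have "(\<integral>\<^sup>+x. f x \<partial>?L (insert i I)) = (\<integral>\<^sup>+x. g x \<partial>?L I)"
    unfolding g_def by (rule product_nn_integral_insert) (use insert in auto)
  also have "\<dots> = ennreal (\<bar>c\<bar> ^ card I) * (\<integral>\<^sup>+x. g (\<lambda>j\<in>I. t j + c * x j) \<partial>?L I)"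
    by (rule insert.IH[OF g])
  also have "(\<integral>\<^sup>+x. g (\<lambda>j\<in>I. t j + c * x j) \<partial>?L I) =
      ennreal \<bar>c\<bar> * (\<integral>\<^sup>+x. \<integral>\<^sup>+y. f (\<lambda>j\<in>insert i I. t j + c * (x(i := y)) j) \<partial>lborel \<partial>?L I)"
    unfolding inner by (rule nn_integral_cmult) measurable
  also have "(\<integral>\<^sup>+x. \<integral>\<^sup>+y. f (\<lambda>j\<in>insert i I. t j + c * (x(i := y)) j) \<partial>lborel \<partial>?L I) =
      (\<integral>\<^sup>+x. f (\<lambda>j\<in>insert i I. t j + c * x j) \<partial>?L (insert i I))"
    by (rule product_nn_integral_insert[symmetric]) (use insert in \<open>auto intro!: measurable_compose[OF _ insert.prems]\<close>)
  finally show ?case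
    using insert.hyps by (simp add: ennreal_mult' mult.assoc mult.left_commute del: restrict_apply)
qed

text \<open>
  Substituting \<open>x \<mapsto> \<mu> + \<surd>(1 + 2 a) (x - \<mu>)\<close> in the total mass of the density yields the Laplace
  transform without diagonalising the quadratic form or knowing its normalising constant.
\<close>
lemma nn_integral_exp_quadratic_gaussian:
  fixes Q :: "(nat \<Rightarrow> real) \<Rightarrow> real" and \<mu> :: "nat \<Rightarrow> real"
  assumes "prob_space M"
    and X: "distributed M (\<Pi>\<^sub>M i\<in>{..<d}. lborel) X (\<lambda>x. ennreal (exp (- Q x / 2) / K))"
    and Q [measurable]: "Q \<in> borel_measurable (\<Pi>\<^sub>M i\<in>{..<d}. lborel)"
    and hom: "\<And>c x. Q (\<lambda>i\<in>{..<d}. (1 - c) * \<mu> i + c * x i) = c\<^sup>2 * Q x"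
    and a: "a \<ge> 0"
  shows "(\<integral>\<^sup>+\<omega>. ennreal (exp (- a * Q (X \<omega>))) \<partial>M) = ennreal ((1 + 2 * a) powr (- real d / 2))"
proof -
  interpret prob_space M by fact
  let ?L = "\<Pi>\<^sub>M i\<in>{..<d}. (lborel :: real measure)"
  let ?E = "\<integral>\<^sup>+\<omega>. ennreal (exp (- a * Q (X \<omega>))) \<partial>M"
  \<comment> \<open>This scale makes \<open>c\<^sup>2 * Q x / 2 = Q x / 2 + a * Q x\<close>, so
    dilating the density about the mean produces exactly the factor
    \<open>exp (- a * Q x)\<close>.\<close>
  define c where "c = sqrt (1 + 2 * a)"
  have c: "c > 0" "c\<^sup>2 = 1 + 2 * a"
    using a by (auto simp: c_def)
  have split: "ennreal (exp (- Q (\<lambda>i\<in>{..<d}. (1 - c) * \<mu> i + c * x i) / 2) / K) =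
      ennreal (exp (- Q x / 2) / K) * ennreal (exp (- a * Q x))" for x
  proof -
    have "- Q (\<lambda>i\<in>{..<d}. (1 - c) * \<mu> i + c * x i) / 2 = - Q x / 2 + - a * Q x"
      unfolding hom c(2) by (simp add: field_simps)
    then have "exp (- Q (\<lambda>i\<in>{..<d}. (1 - c) * \<mu> i + c * x i) / 2) / K = exp (- Q x / 2) / K * exp (- a * Q x)"
      by (simp only: exp_add) simp
    \<comment> \<open>The sign of \<open>K\<close> is unknown here; nonnegativity of the second
      factor is enough to split the product.\<close>
    then show ?thesis
      by (simp only: ennreal_mult'' exp_ge_zero)
  qed
  have "1 = (\<integral>\<^sup>+x. ennreal (exp (- Q x / 2) / K) \<partial>?L)"
    using distributed_nn_integral[OF X, of "\<lambda>_. 1"] emeasure_space_1 by simp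
  also have "\<dots> = ennreal (c ^ d) * (\<integral>\<^sup>+x. ennreal (exp (- Q (\<lambda>i\<in>{..<d}. (1 - c) * \<mu> i + c * x i) / 2) / K) \<partial>?L)"
    using c by (subst nn_integral_PiM_lborel_affine[where c = c and t = "\<lambda>i. (1 - c) * \<mu> i"]) auto
  also have "\<dots> = ennreal (c ^ d) * ?E"
    unfolding split by (subst distributed_nn_integral[OF X]) auto
  \<comment> \<open>Cancellation can fail in \<open>ennreal\<close> for 0 and infinity, so the
    equation is multiplied by the reciprocal of the positive real \<open>c ^ d\<close>.\<close>
  finally have "ennreal (1 / c ^ d) * 1 = ennreal (1 / c ^ d) * (ennreal (c ^ d) * ?E)"
    by simp
  also have "\<dots> = ?E"
    using c by (simp add: mult.assoc[symmetric] ennreal_mult'[symmetric])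
  finally have "?E = ennreal (1 / c ^ d)"
    by simp
  also have "1 / c ^ d = (1 + 2 * a) powr (- real d / 2)"
    using a by (simp add: c_def powr_half_sqrt[symmetric] powr_powr powr_minus_divide flip: powr_realpow)
  finally show ?thesis .
qed

section \<open>Integral representation of the expected weight and its limit\<close>

lemma nn_integral_exp_atLeast_0:
  fixes b :: real
  assumes "b > 0"
  shows "(\<integral>\<^sup>+s. ennreal (exp (- b * s)) * indicator {0..} s \<partial>lborel) = ennreal (1 / b)"
proof -
  have "((\<lambda>s. - exp (- b * s) / b) \<longlongrightarrow> 0) at_top"
    using assms by real_asymp
  then show ?thesis
    using assms
    by (subst nn_integral_FTC_atLeast[where F = "\<lambda>s. - exp (- b * s) / b" and T = 0])
       (auto intro!: derivative_eq_intros)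
qed

text \<open>Working with nonnegative integrals makes the exchange of integrals depend on
  measurability alone; the passage to Bochner integrals comes last. The indicator keeps
  \<open>s\<close> in the range where \<open>\<phi>\<close> is known to be the Laplace transform of
  \<open>U\<close>.\<close>

lemma (in prob_space) expectation_inverse_one_plus:
  fixes U :: "'a \<Rightarrow> real" and \<phi> :: "real \<Rightarrow> real"
  assumes [measurable]: "random_variable borel U" "\<phi> \<in> borel_measurable borel"
    and U: "\<And>\<omega>. \<omega> \<in> space M \<Longrightarrow> U \<omega> \<ge> 0" 
    and lap: "\<And>s. s \<ge> 0 \<Longrightarrow> (\<integral>\<^sup>+\<omega>. ennreal (exp (- s * U \<omega>)) \<partial>M) = ennreal (\<phi> s)"
    and nonneg: "\<And>s. s \<ge> 0 \<Longrightarrow> \<phi> s \<ge> 0"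
  shows "expectation (\<lambda>\<omega>. 1 / (1 + U \<omega>)) = (\<integral>s. exp (- s) * \<phi> s * indicator {0..} s \<partial>lborel)"
proof -
  interpret pair_sigma_finite M "lborel :: real measure"
    by standard
  have "(\<integral>\<^sup>+\<omega>. ennreal (1 / (1 + U \<omega>)) \<partial>M) =
      (\<integral>\<^sup>+\<omega>. \<integral>\<^sup>+s. ennreal (exp (- (1 + U \<omega>) * s)) * indicator {0..} s \<partial>lborel \<partial>M)"
    by (intro nn_integral_cong nn_integral_exp_atLeast_0[symmetric]) (use U in fastforce)
  also have "\<dots> = (\<integral>\<^sup>+s. \<integral>\<^sup>+\<omega>. ennreal (exp (- (1 + U \<omega>) * s)) * indicator {0..} s \<partial>M \<partial>lborel)"
    by (rule Fubini'[symmetric]) measurable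
  also have "\<dots> = (\<integral>\<^sup>+s. ennreal (exp (- s) * \<phi> s * indicator {0..} s) \<partial>lborel)"
  proof (rule nn_integral_cong)
    fix s :: real
    show "(\<integral>\<^sup>+\<omega>. ennreal (exp (- (1 + U \<omega>) * s)) * indicator {0..} s \<partial>M) =
        ennreal (exp (- s) * \<phi> s * indicator {0..} s)"
    proof (cases "s \<ge> 0")
      case True
      have "exp (- (1 + U \<omega>) * s) = exp (- s) * exp (- s * U \<omega>)" for \<omega>
        by (simp add: algebra_simps flip: exp_add)
      then show ?thesis
        using True lap[OF True] nonneg[OF True]
        by (simp add: ennreal_mult nn_integral_cmult)
    qed simp
  qed
  finally have "(\<integral>\<^sup>+\<omega>. ennreal (1 / (1 + U \<omega>)) \<partial>M) = (\<integral>\<^sup>+s. ennreal (exp (- s) * \<phi> s * indicator {0..} s) \<partial>lborel)" .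
  moreover have "AE \<omega> in M. 0 \<le> 1 / (1 + U \<omega>)"
    using U by (auto intro!: divide_nonneg_nonneg add_nonneg_nonneg)
  moreover have "AE s in lborel. 0 \<le> exp (- s) * \<phi> s * indicator {0..} s"
    using nonneg by (auto simp: indicator_def)
  ultimately show ?thesis
    by (simp add: integral_eq_nn_integral)
qed

text \<open>The \<open>powr\<close> factor is the Laplace transform at \<open>s / d\<close> of a
  chi-square variable with \<open>d\<close> degrees of freedom. Such a variable divided by
  \<open>d\<close> concentrates at 1, which explains the pointwise limit \<open>exp (- s)\<close>
  and the value 1/2 = 1/(1 + 1).\<close>

lemma tendsto_integral_laplace_chi_square:
  "(\<lambda>d. \<integral>s. exp (- s) * (1 + 2 * (s / real d)) powr (- real d / 2) * indicator {0..} s \<partial>lborel) \<longlonglongrightarrow> 1 / 2"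
proof -
  \<comment> \<open>Used with \<open>b = 1\<close> for the dominating function and with
    \<open>b = 2\<close> for the limit.\<close>
  have int: "has_bochner_integral lborel (\<lambda>s. exp (- b * s) * indicator {0..} s) (1 / b)" if "b > 0" for b :: real
    using that nn_integral_exp_atLeast_0[OF that]
    by (intro has_bochner_integral_nn_integral) (auto simp: ennreal_mult' ennreal_indicator)
  have "(\<lambda>d. \<integral>s. exp (- s) * (1 + 2 * (s / real d)) powr (- real d / 2) * indicator {0..} s \<partial>lborel)
      \<longlonglongrightarrow> (\<integral>s. exp (- 2 * s) * indicator {0..} s \<partial>lborel)"
  proof (rule integral_dominated_convergence[where w = "\<lambda>s. exp (- 1 * s) * indicator {0..} s"])
    show "integrable lborel (\<lambda>s::real. exp (- 1 * s) * indicator {0..} s)"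
      using int[of 1] by (auto simp: has_bochner_integral_iff)
    show "AE s in lborel. (\<lambda>d. exp (- s) * (1 + 2 * (s / real d)) powr (- real d / 2) * indicator {0..} s)
        \<longlonglongrightarrow> exp (- 2 * s) * indicator {0..} s"
    proof (rule AE_I2)
      fix s :: real
      show "(\<lambda>d. exp (- s) * (1 + 2 * (s / real d)) powr (- real d / 2) * indicator {0..} s)
          \<longlonglongrightarrow> exp (- 2 * s) * indicator {0..} s"
      proof (cases "s \<ge> 0")
        case True
        have "(\<lambda>d. (1 + 2 * (s / real d)) powr (- real d / 2)) \<longlonglongrightarrow> exp (- s)"
          by real_asymp
        from tendsto_mult[OF tendsto_const[of "exp (- s)"] this] True show ?thesis
          by (simp flip: exp_add)
      qed simp
    qed
    show "AE s in lborel. norm (exp (- s) * (1 + 2 * (s / real d)) powr (- real d / 2) * indicator {0..} s)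
        \<le> exp (- 1 * s) * indicator {0..} s" for d
    proof (rule AE_I2)
      fix s :: real
      show "norm (exp (- s) * (1 + 2 * (s / real d)) powr (- real d / 2) * indicator {0..} s)
          \<le> exp (- 1 * s) * indicator {0..} s"
      proof (cases "s \<ge> 0")
        case True
        \<comment> \<open>The base is at least 1 and the exponent is at most 0. For
          \<open>d = 0\<close> the convention \<open>s / 0 = 0\<close> gives the value 1, so the
          bound holds for every \<open>d\<close>.\<close>
        then have "(1 + 2 * (s / real d)) powr (- real d / 2) \<le> 1"
          by (simp add: powr_minus_divide divide_simps ge_one_powr_ge_zero)
        then show ?thesis
          using True by (simp add: mult_left_le)
      qed simp
    qed
  qed measurable
  also have "(\<integral>s. exp (- 2 * s) * indicator {0..} s \<partial>lborel) = 1 / (2 :: real)"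
    by (rule has_bochner_integral_integral_eq[OF int]) simp
  finally show ?thesis .
qed

section \<open>The Mahalanobis norm of a Gaussian vector\<close>

lemma weighted_sq_norm_smult:
  assumes "B \<in> carrier_mat d d" "v \<in> carrier_vec d"
  shows "weighted_sq_norm B (c \<cdot>\<^sub>v v) = c\<^sup>2 * weighted_sq_norm B v"
  using assms by (simp add: weighted_sq_norm_def mult_mat_vec power2_eq_square)

text \<open>Writing the form as a polynomial in the coordinates gives its measurability on the
  product space.\<close>

lemma weighted_sq_norm_diff_eq_sum:
  assumes "B \<in> carrier_mat d d" "\<mu> \<in> carrier_vec d"
  shows "weighted_sq_norm B (Matrix.vec d x - \<mu>) =
    (\<Sum>i<d. (x i - \<mu> $ i) * (\<Sum>j<d. B $$ (i, j) * (x j - \<mu> $ j)))"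
  using assms
  by (auto simp: weighted_sq_norm_def scalar_prod_def mult_mat_vec_def atLeast0LessThan intro!: sum.cong)

lemma gaussian_vector_mahalanobis:
  assumes M: "prob_space M" and \<Sigma>: "sym_pos_def d \<Sigma>" and \<mu>: "\<mu> \<in> carrier_vec d"
    and Y: "gaussian_vector M d \<mu> \<Sigma> Y"
  shows "(\<lambda>\<omega>. weighted_sq_norm (mat_inv \<Sigma>) (Y \<omega> - \<mu>)) \<in> borel_measurable M"
    and "a \<ge> 0 \<Longrightarrow>
      (\<integral>\<^sup>+\<omega>. ennreal (exp (- a * weighted_sq_norm (mat_inv \<Sigma>) (Y \<omega> - \<mu>))) \<partial>M) =
      ennreal ((1 + 2 * a) powr (- real d / 2))"
proof -
  note B = sym_pos_def_mat_inv(1)[OF \<Sigma>]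
  define Q where "Q x = weighted_sq_norm (mat_inv \<Sigma>) (Matrix.vec d x - \<mu>)" for x
  define X where "X = (\<lambda>\<omega>. \<lambda>i\<in>{..<d}. Y \<omega> $ i)"
  have Q: "Q \<in> borel_measurable (\<Pi>\<^sub>M i\<in>{..<d}. lborel)"
    unfolding Q_def weighted_sq_norm_diff_eq_sum[OF B \<mu>] by measurable
  have X: "distributed M (\<Pi>\<^sub>M i\<in>{..<d}. lborel) X
      (\<lambda>x. ennreal (exp (- Q x / 2) / sqrt ((2 * pi) ^ d * Determinant.det \<Sigma>)))"
    using Y unfolding gaussian_vector_def gaussian_density_def Q_def X_def by blast
  \<comment> \<open>The law is that of the coordinate tuple \<open>X \<omega>\<close>, while the
    claim concerns the vector \<open>Y \<omega>\<close>; \<open>Matrix.vec d\<close> recovers the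
    vector from the tuple.\<close>
  have QX: "weighted_sq_norm (mat_inv \<Sigma>) (Y \<omega> - \<mu>) = Q (X \<omega>)" if "\<omega> \<in> space M" for \<omega>
  proof -
    have "Matrix.vec d (X \<omega>) = Y \<omega>"
      using Y that by (intro eq_vecI) (auto simp: gaussian_vector_def X_def)
    then show ?thesis
      by (simp add: Q_def)
  qed
  have "(\<lambda>\<omega>. Q (X \<omega>)) \<in> borel_measurable M"
    using distributed_measurable[OF X] Q by (rule measurable_compose)
  then show "(\<lambda>\<omega>. weighted_sq_norm (mat_inv \<Sigma>) (Y \<omega> - \<mu>)) \<in> borel_measurable M"
    by (subst measurable_cong[OF QX])
  \<comment> \<open>The affine map is the dilation by \<open>c\<close> about the mean, so it
    multiplies the deviation from the mean by \<open>c\<close>.\<close>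
  have hom: "Q (\<lambda>i\<in>{..<d}. (1 - c) * \<mu> $ i + c * x i) = c\<^sup>2 * Q x" for c x
  proof -
    have "Matrix.vec d (\<lambda>i\<in>{..<d}. (1 - c) * \<mu> $ i + c * x i) - \<mu> = c \<cdot>\<^sub>v (Matrix.vec d x - \<mu>)"
      using \<mu> by (intro eq_vecI) (auto simp: algebra_simps)
    then show ?thesis
      using weighted_sq_norm_smult[OF B, of "Matrix.vec d x - \<mu>" c] \<mu> by (simp add: Q_def)
  qed
  show "(\<integral>\<^sup>+\<omega>. ennreal (exp (- a * weighted_sq_norm (mat_inv \<Sigma>) (Y \<omega> - \<mu>))) \<partial>M) =
      ennreal ((1 + 2 * a) powr (- real d / 2))" if a: "a \<ge> 0"
    using nn_integral_exp_quadratic_gaussian[OF M X Q hom a]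
    by (simp add: QX cong: nn_integral_cong)
qed

section \<open>The score matching weight and the analysis precision\<close>

text \<open>The Mahalanobis term is nonnegative, so the squared weight lies in (0, 1]. The upper
  bound serves integrability, and positivity makes \<open>dsm_obs_cov\<close> a positive multiple of
  \<open>R\<close>. For \<open>q = 0\<close> division by zero makes the weight 1.\<close>

lemma dsm_k_sq:
  assumes H: "H \<in> carrier_mat n k" and m: "m \<in> carrier_vec k"
    and P: "sym_pos_def k P" and R: "sym_pos_def n R" and y: "y \<in> carrier_vec n"
  shows "(dsm_k q H m P R y)\<^sup>2 =
      1 / (1 + weighted_sq_norm (mat_inv (innovation_cov H P R)) (y - H *\<^sub>v m) / q\<^sup>2)"
    and "(dsm_k q H m P R y)\<^sup>2 > 0" "(dsm_k q H m P R y)\<^sup>2 \<le> 1"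
proof -
  let ?U = "weighted_sq_norm (mat_inv (innovation_cov H P R)) (y - H *\<^sub>v m)"
  have "?U \<ge> 0"
    using sym_pos_def_innovation_cov[OF H P R] H m y
    by (intro weighted_sq_norm_mat_inv_nonneg[where d = n]) auto
  then have U: "?U / q\<^sup>2 \<ge> 0"
    by simp
  then show eq: "(dsm_k q H m P R y)\<^sup>2 = 1 / (1 + ?U / q\<^sup>2)"
    by (simp add: dsm_k_def powr_minus_divide powr_half_sqrt power_divide)
  show "(dsm_k q H m P R y)\<^sup>2 > 0" "(dsm_k q H m P R y)\<^sup>2 \<le> 1"
    using U unfolding eq by (simp_all add: add_pos_nonneg)
qed

text \<open>For a fixed observation the modified covariance is \<open>R\<close> scaled by the
  positive number \<open>1 / c\<close>, so the Woodbury formula applies and inversion turns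
  \<open>1 / c\<close> into \<open>c\<close>.\<close>

lemma dsm_analysis_precision_eq:
  assumes H: "H \<in> carrier_mat n k" and m: "m \<in> carrier_vec k"
    and P: "sym_pos_def k P" and R: "sym_pos_def n R" and y: "y \<in> carrier_vec n"
  shows "dsm_analysis_precision q H m P R y =
    mat_inv P + (2 * (dsm_k q H m P R y)\<^sup>2) \<cdot>\<^sub>m (H\<^sup>T * mat_inv R * H)"
proof -
  define c where "c = 2 * (dsm_k q H m P R y)\<^sup>2"
  have c: "c > 0"
    using dsm_k_sq(2)[OF assms] by (simp add: c_def)
  note Ri = sym_pos_def_mat_inv(1)[OF R]
  have HT: "H\<^sup>T \<in> carrier_mat k n"
    using H by simp
  have "analysis_precision H P ((1 / c) \<cdot>\<^sub>m R) = mat_inv P + H\<^sup>T * (c \<cdot>\<^sub>m mat_inv R) * H"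
    using analysis_precision_eq[OF H P sym_pos_def_smult[OF R]] mat_inv_smult[OF R] c by simp
  also have "H\<^sup>T * (c \<cdot>\<^sub>m mat_inv R) * H = c \<cdot>\<^sub>m (H\<^sup>T * mat_inv R * H)"
    by (simp only: mult_smult_distrib[OF HT Ri] mult_smult_assoc_mat[OF mult_carrier_mat[OF HT Ri] H])
  finally show ?thesis
    by (simp only: dsm_analysis_precision_def dsm_obs_cov_def c_def)
qed

text \<open>The expectation depends on the system only through \<open>n\<close>, since whitening
  removes \<open>H\<close>, \<open>m\<close>, \<open>P\<close> and \<open>R\<close> from the law of
  the Mahalanobis norm. The limit over systems is thereby reduced to one numerical sequence.\<close>

lemma dsm_k_sq_integrable_and_integral:
  assumes M: "prob_space M" and H: "H \<in> carrier_mat n k" and m: "m \<in> carrier_vec k"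
    and P: "sym_pos_def k P" and R: "sym_pos_def n R"
    and Y: "gaussian_vector M n (H *\<^sub>v m) (innovation_cov H P R) Y"
    and q: "q\<^sup>2 = real n"
  shows "integrable M (\<lambda>\<omega>. (dsm_k q H m P R (Y \<omega>))\<^sup>2)"
    and "(\<integral>\<omega>. (dsm_k q H m P R (Y \<omega>))\<^sup>2 \<partial>M) =
      (\<integral>s. exp (- s) * (1 + 2 * (s / real n)) powr (- real n / 2) * indicator {0..} s \<partial>lborel)"
proof -
  interpret prob_space M by fact
  note S = sym_pos_def_innovation_cov[OF H P R]
  have \<mu>: "H *\<^sub>v m \<in> carrier_vec n"
    using H m by auto
  have Yc: "Y \<omega> \<in> carrier_vec n" if "\<omega> \<in> space M" for \<omega>
    using Y that by (simp add: gaussian_vector_def)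
  define U where "U \<omega> = weighted_sq_norm (mat_inv (innovation_cov H P R)) (Y \<omega> - H *\<^sub>v m) / real n" for \<omega>
  note k = dsm_k_sq[OF H m P R Yc, where q = q]
  have k_U: "(dsm_k q H m P R (Y \<omega>))\<^sup>2 = 1 / (1 + U \<omega>)" if "\<omega> \<in> space M" for \<omega>
    using k(1)[OF that] by (simp add: U_def q)
  note [measurable] = gaussian_vector_mahalanobis(1)[OF M S \<mu> Y]
  have U [measurable]: "U \<in> borel_measurable M"
    unfolding U_def by measurable
  have "(\<lambda>\<omega>. (dsm_k q H m P R (Y \<omega>))\<^sup>2) \<in> borel_measurable M"
    by (subst measurable_cong[OF k_U]) auto
  then show "integrable M (\<lambda>\<omega>. (dsm_k q H m P R (Y \<omega>))\<^sup>2)"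
    using k by (intro integrable_const_bound[where B = 1]) auto
  have "(\<integral>\<omega>. (dsm_k q H m P R (Y \<omega>))\<^sup>2 \<partial>M) = expectation (\<lambda>\<omega>. 1 / (1 + U \<omega>))"
    by (intro Bochner_Integration.integral_cong refl k_U)
  also have "\<dots> = (\<integral>s. exp (- s) * (1 + 2 * (s / real n)) powr (- real n / 2) * indicator {0..} s \<partial>lborel)"
  proof (rule expectation_inverse_one_plus)
    show "U \<omega> \<ge> 0" if "\<omega> \<in> space M" for \<omega>
      unfolding U_def using weighted_sq_norm_mat_inv_nonneg[OF S] Yc[OF that] \<mu> by simp
    \<comment> \<open>Since \<open>U\<close> is the squared norm divided by \<open>n\<close>, its
      transform at \<open>s\<close> is that of the squared norm at \<open>s / n\<close>. For
      \<open>n = 0\<close> both sides are 1.\<close>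
    show "(\<integral>\<^sup>+\<omega>. ennreal (exp (- s * U \<omega>)) \<partial>M) =
        ennreal ((1 + 2 * (s / real n)) powr (- real n / 2))" if "s \<ge> 0" for s
      using gaussian_vector_mahalanobis(2)[OF M S \<mu> Y, of "s / real n"] that by (simp add: U_def)
  qed auto
  finally show "(\<integral>\<omega>. (dsm_k q H m P R (Y \<omega>))\<^sup>2 \<partial>M) =
      (\<integral>s. exp (- s) * (1 + 2 * (s / real n)) powr (- real n / 2) * indicator {0..} s \<partial>lborel)" .
qed

text \<open>The systems along the sequence need not be related to one another, so the limit does not
  depend on how they grow. Integrability is asserted explicitly because a Bochner integral of a
  non-integrable function is 0 by default.\<close>

theorem proposition2:
  fixes M :: "nat \<Rightarrow> 'a measure"
    and dX dY :: "nat \<Rightarrow> nat"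
    and H P R :: "nat \<Rightarrow> real Matrix.mat"
    and m :: "nat \<Rightarrow> real Matrix.vec"
    and Y :: "nat \<Rightarrow> 'a \<Rightarrow> real Matrix.vec"
    and q :: "nat \<Rightarrow> real"
  assumes prob: "\<And>s. prob_space (M s)"
    and H: "\<And>s. H s \<in> carrier_mat (dY s) (dX s)"
    and m: "\<And>s. m s \<in> carrier_vec (dX s)"
    and P: "\<And>s. sym_pos_def (dX s) (P s)"
    and R: "\<And>s. sym_pos_def (dY s) (R s)"
    and Y: "\<And>s. gaussian_vector (M s) (dY s) (H s *\<^sub>v m s) (innovation_cov (H s) (P s) (R s)) (Y s)"
    and q: "\<And>s. (q s)\<^sup>2 = real (dY s)"
    and dY: "filterlim dY at_top sequentially"
  shows "
    (\<forall>s. analysis_precision (H s) (P s) (R s) =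
               mat_inv (P s) + (H s)\<^sup>T * mat_inv (R s) * H s) \<and>
    (\<forall>s. \<forall>y \<in> carrier_vec (dY s).
           dsm_analysis_precision (q s) (H s) (m s) (P s) (R s) y =
             mat_inv (P s) +
             (2 * (dsm_k (q s) (H s) (m s) (P s) (R s) y)\<^sup>2) \<cdot>\<^sub>m ((H s)\<^sup>T * mat_inv (R s) * H s)) \<and>
    (\<forall>s. integrable (M s) (\<lambda>\<omega>. 2 * (dsm_k (q s) (H s) (m s) (P s) (R s) (Y s \<omega>))\<^sup>2)) \<and>
    (\<forall>s. \<forall>i < dX s. \<forall>j < dX s.
           integrable (M s)
             (\<lambda>\<omega>. dsm_analysis_precision (q s) (H s) (m s) (P s) (R s) (Y s \<omega>) $$ (i, j))) \<and>
    (\<forall>s. mat_expectation (M s) (dX s) (dX s)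
               (\<lambda>\<omega>. dsm_analysis_precision (q s) (H s) (m s) (P s) (R s) (Y s \<omega>)) =
             mat_inv (P s) +
             integral\<^sup>L (M s) (\<lambda>\<omega>. 2 * (dsm_k (q s) (H s) (m s) (P s) (R s) (Y s \<omega>))\<^sup>2) \<cdot>\<^sub>m
               ((H s)\<^sup>T * mat_inv (R s) * H s)) \<and>
    ((\<lambda>s. integral\<^sup>L (M s) (\<lambda>\<omega>. 2 * (dsm_k (q s) (H s) (m s) (P s) (R s) (Y s \<omega>))\<^sup>2))
           \<longlonglongrightarrow> 1)"
proof -
  note Pi = sym_pos_def_mat_inv(1)[OF P] and Ri = sym_pos_def_mat_inv(1)[OF R]
  define k2 where "k2 s \<omega> = 2 * (dsm_k (q s) (H s) (m s) (P s) (R s) (Y s \<omega>))\<^sup>2" for s \<omega>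
  define G where "G s = (H s)\<^sup>T * mat_inv (R s) * H s" for s
  define J where "J s \<omega> = dsm_analysis_precision (q s) (H s) (m s) (P s) (R s) (Y s \<omega>)" for s \<omega>
  have G: "G s \<in> carrier_mat (dX s) (dX s)" for s
    using H[of s] Ri[of s] by (auto simp: G_def)
  note k2 = dsm_k_sq_integrable_and_integral[OF prob H m P R Y q]
  have int: "integrable (M s) (k2 s)" for s
    unfolding k2_def using k2(1) by simp
  have "J s \<omega> = mat_inv (P s) + k2 s \<omega> \<cdot>\<^sub>m G s" if "\<omega> \<in> space (M s)" for s \<omega>
    using dsm_analysis_precision_eq[OF H m P R] Y[of s] that
    by (auto simp: J_def k2_def G_def gaussian_vector_def)
  then have J: "J s \<omega> $$ (i, j) = mat_inv (P s) $$ (i, j) + k2 s \<omega> * G s $$ (i, j)"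
    if "\<omega> \<in> space (M s)" "i < dX s" "j < dX s" for s \<omega> i j
    using that G[of s] Pi[of s] by auto
  \<comment> \<open>Each entry is affine in \<open>k2\<close> with deterministic coefficients, and
    the constant term keeps its value because the total mass is 1.\<close>
  have J_int: "integrable (M s) (\<lambda>\<omega>. J s \<omega> $$ (i, j))"
    and J_eq: "(\<integral>\<omega>. J s \<omega> $$ (i, j) \<partial>M s) = mat_inv (P s) $$ (i, j) + (\<integral>\<omega>. k2 s \<omega> \<partial>M s) * G s $$ (i, j)"
    if "i < dX s" "j < dX s" for s i j
  proof -
    interpret prob_space "M s" by (rule prob)
    show "integrable (M s) (\<lambda>\<omega>. J s \<omega> $$ (i, j))"
      using int[of s] that by (simp add: J cong: Bochner_Integration.integrable_cong)
    show "(\<integral>\<omega>. J s \<omega> $$ (i, j) \<partial>M s) = mat_inv (P s) $$ (i, j) + (\<integral>\<omega>. k2 s \<omega> \<partial>M s) * G s $$ (i, j)"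
      using int[of s] that by (simp add: J prob_space cong: Bochner_Integration.integral_cong)
  qed
  have "mat_expectation (M s) (dX s) (dX s) (J s) = mat_inv (P s) + integral\<^sup>L (M s) (k2 s) \<cdot>\<^sub>m G s" for s
    using G[of s] Pi[of s] J_eq[of _ s] by (intro eq_matI) (auto simp: mat_expectation_def)
  moreover have "(\<lambda>s. integral\<^sup>L (M s) (k2 s)) \<longlonglongrightarrow> 1"
    \<comment> \<open>What remains is twice the fixed numerical sequence evaluated at
      \<open>dY s\<close>; its limit 1/2 composes with the divergence of \<open>dY\<close>.\<close>
    unfolding k2_def integral_mult_right_zero k2(2)
    using tendsto_mult_left[OF filterlim_compose[OF tendsto_integral_laplace_chi_square dY], of 2]
    by simp
  ultimately show ?thesis
    using analysis_precision_eq[OF H P R] dsm_analysis_precision_eq[OF H m P R] int J_int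
    unfolding k2_def J_def G_def by simp
qed

end
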